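(* Let $A=[a_{ij}]\in\mathbb{R}^{n\times n}$ be a triangular matrix. Then the following are equivalent: (i) $A\in\mathbf{Q}$. (ii) The diagonal of $A$ is positive (i.e., $a_{ii}>0$ for all $i$). (iii) $A\in\mathbf{P}$. (iv) $A\in\mathbf{E}$. (v) The diagonal of $A$ is nonnegative and $A\in\mathbf{R}_0$. (vi) $A\in\mathbf{R}^*$.
   Context: For $A\in\mathbb{R}^{n\times n}$ and $q\in\mathbb{R}^n$, $\mathrm{LCP}(A,q)$ is the problem of finding $x\in\mathbb{R}^n$ with $x\ge 0$, $Ax+q\ge 0$ and $x^\top(Ax+q)=0$ (inequalities between vectors are componentwise; $d>0$ means all components of $d$ are positive). - $A\in\mathbf{Q}$ if $\mathrm{LCP}(A,q)$ has a solution for every $q\in\mathbb{R}^n$. - $A\in\mathbf{R}_0$ if $x=0$ is the only solution of $\mathrm{LCP}(A,0)$. - $A\in\mathbf{E}_0$ (respectively $A\in\mathbf{E}$) if for every $d>0$ (respectively every $d\ge 0$) in $\mathbb{R}^n$, $x=0$ is the only solution of $\mathrm{LCP}(A,d)$. - $A\in\mathbf{R}^*$ if $A\in\mathbf{R}_0$ and $A\in\mathbf{E}_0$. - $A\in\mathbf{P}$ if all principal minors of $A$ are positive. A matrix is upper triangular if $a_{ij}=0$ for all $i>j$, lower triangular if its transpose is upper triangular, and triangular if it is upper or lower triangular. *)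

theory Defs
  imports "Jordan_Normal_Form.Determinant" "Jordan_Normal_Form.DL_Submatrix"
begin

definition LCP :: "real mat \<Rightarrow> real vec \<Rightarrow> real vec set" where
  "LCP A q = {x \<in> carrier_vec (dim_vec q).
     0\<^sub>v (dim_vec q) \<le> x \<and> 0\<^sub>v (dim_vec q) \<le> A *\<^sub>v x + q \<and> x \<bullet> (A *\<^sub>v x + q) = 0}"

definition Q_matrices :: "nat \<Rightarrow> real mat set" where
  "Q_matrices n = {A \<in> carrier_mat n n. \<forall>q \<in> carrier_vec n. LCP A q \<noteq> {}}"

definition R0_matrices :: "nat \<Rightarrow> real mat set" where
  "R0_matrices n = {A \<in> carrier_mat n n. LCP A (0\<^sub>v n) = {0\<^sub>v n}}"

text \<open>The library's strict order on vectors is the strict part of the componentwise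
  order (not all components need be strictly larger), so \<open>d > 0\<close> is written out componentwise.\<close>

definition E0_matrices :: "nat \<Rightarrow> real mat set" where
  "E0_matrices n = {A \<in> carrier_mat n n.
     \<forall>d \<in> carrier_vec n. (\<forall>i<n. d $ i > 0) \<longrightarrow> LCP A d = {0\<^sub>v n}}"

text \<open>Here \<open>d = 0\<close> is allowed.\<close>

definition E_matrices :: "nat \<Rightarrow> real mat set" where
  "E_matrices n = {A \<in> carrier_mat n n.
     \<forall>d \<in> carrier_vec n. 0\<^sub>v n \<le> d \<longrightarrow> LCP A d = {0\<^sub>v n}}"

definition Rstar_matrices :: "nat \<Rightarrow> real mat set" where
  "Rstar_matrices n = R0_matrices n \<inter> E0_matrices n"

definition P_matrices :: "nat \<Rightarrow> real mat set" where
  "P_matrices n = {A \<in> carrier_mat n n.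
     \<forall>I. I \<noteq> {} \<and> I \<subseteq> {..<n} \<longrightarrow> det (submatrix A I I) > 0}"

definition lower_triangular :: "real mat \<Rightarrow> bool" where
  "lower_triangular A \<longleftrightarrow> upper_triangular (transpose_mat A)"

definition triangular :: "real mat \<Rightarrow> bool" where
  "triangular A \<longleftrightarrow> upper_triangular A \<or> lower_triangular A"

end

theory Submission
  imports Defs
begin

text \<open>Upper and lower triangular matrices are treated together through a rank \<open>f\<close> on the indices
  such that row \<open>i\<close> involves, besides the diagonal, only columns of smaller rank. Since the
  complementarity conditions hold row by row, an LCP is then solved one index at a time in order of
  increasing rank: positive diagonal entries allow this for every \<open>q\<close>, and force the zero solution
  for \<open>q \<ge> 0\<close>. If \<open>a\<^sub>k\<^sub>k \<le> 0\<close> with \<open>k\<close> of minimal rank, the right-hand side with \<open>-1\<close> at \<open>k\<close> and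
  \<open>1\<close> elsewhere has no solution. If the diagonal is nonnegative and \<open>a\<^sub>k\<^sub>k = 0\<close> with \<open>k\<close> of maximal
  rank, the unit vector \<open>e\<^sub>k\<close> extends to a nonzero solution of the homogeneous problem.\<close>

section \<open>Row-by-row form of the LCP, and its solvability along a rank\<close>

lemma mem_LCP_iff:
  assumes A: "A \<in> carrier_mat n n" and q: "q \<in> carrier_vec n"
  shows "x \<in> LCP A q \<longleftrightarrow> x \<in> carrier_vec n \<and>
    (\<forall>i<n. 0 \<le> x $ i \<and> 0 \<le> (\<Sum>j<n. A $$ (i, j) * x $ j) + q $ i \<and>
      x $ i * ((\<Sum>j<n. A $$ (i, j) * x $ j) + q $ i) = 0)"
proof (cases "x \<in> carrier_vec n")
  case x: True
  define w where "w = A *\<^sub>v x + q"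
  have w: "w $ i = (\<Sum>j<n. A $$ (i, j) * x $ j) + q $ i" if "i < n" for i
    using that A q x by (simp add: w_def scalar_prod_def lessThan_atLeast0)
  have w_dim: "dim_vec w = n"
    using q by (simp add: w_def)
  have "x \<in> LCP A q \<longleftrightarrow> 0\<^sub>v n \<le> x \<and> 0\<^sub>v n \<le> w \<and> x \<bullet> w = 0"
    using x q by (simp add: LCP_def w_def)
  also have "\<dots> \<longleftrightarrow> (\<forall>i<n. 0 \<le> x $ i) \<and> (\<forall>i<n. 0 \<le> w $ i) \<and> (\<Sum>i<n. x $ i * w $ i) = 0"
    using x w_dim by (auto simp: less_eq_vec_def scalar_prod_def lessThan_atLeast0)
  \<comment> \<open>A sum of nonnegative products vanishes only if every product does.\<close>
  also have "\<dots> \<longleftrightarrow> (\<forall>i<n. 0 \<le> x $ i \<and> 0 \<le> w $ i \<and> x $ i * w $ i = 0)"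
  proof -
    have "(\<Sum>i<n. x $ i * w $ i) = 0 \<longleftrightarrow> (\<forall>i<n. x $ i * w $ i = 0)"
      if "\<forall>i<n. 0 \<le> x $ i" and "\<forall>i<n. 0 \<le> w $ i"
      using that by (subst sum_nonneg_eq_0_iff) auto
    then show ?thesis by blast
  qed
  finally show ?thesis
    using x w by simp
next
  case False
  then show ?thesis
    using q by (auto simp: LCP_def)
qed

lemma zero_mem_LCP:
  assumes "A \<in> carrier_mat n n" and "d \<in> carrier_vec n" and "\<And>i. i < n \<Longrightarrow> 0 \<le> d $ i"
  shows "0\<^sub>v n \<in> LCP A d"
  unfolding mem_LCP_iff[OF assms(1,2)] using assms by simp

text \<open>Induction adding an index \<open>m\<close> of maximal rank: column \<open>m\<close>
  vanishes in the earlier rows, so their solution survives, and row \<open>m\<close> becomes an LCP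
  in one unknown. General index sets are allowed because the lemma is applied both to all indices
  and to those above a given rank.\<close>

lemma ranked_complementarity_solvable:
  fixes a :: "nat \<Rightarrow> nat \<Rightarrow> real" and q :: "nat \<Rightarrow> real" and f :: "nat \<Rightarrow> nat"
  assumes "finite I"
    and "\<And>i j. i \<in> I \<Longrightarrow> j \<in> I \<Longrightarrow> i \<noteq> j \<Longrightarrow> f i \<le> f j \<Longrightarrow> a i j = 0"
    and "\<And>i. i \<in> I \<Longrightarrow> 0 < a i i"
  shows "\<exists>x. (\<forall>i. i \<notin> I \<longrightarrow> x i = 0) \<and>
    (\<forall>i\<in>I. 0 \<le> x i \<and> 0 \<le> (\<Sum>j\<in>I. a i j * x j) + q i \<and> x i * ((\<Sum>j\<in>I. a i j * x j) + q i) = 0)"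
  using assms
proof (induction I rule: finite_ranking_induct[where f = f])
  case empty
  show ?case by auto
next
  case (insert m S)
  have "\<exists>x. (\<forall>i. i \<notin> S \<longrightarrow> x i = 0) \<and>
    (\<forall>i\<in>S. 0 \<le> x i \<and> 0 \<le> (\<Sum>j\<in>S. a i j * x j) + q i \<and> x i * ((\<Sum>j\<in>S. a i j * x j) + q i) = 0)"
    using insert.prems by (intro insert.IH) auto
  then obtain x where x0: "\<And>i. i \<notin> S \<Longrightarrow> x i = 0"
    and x: "\<And>i. i \<in> S \<Longrightarrow> 0 \<le> x i \<and> 0 \<le> (\<Sum>j\<in>S. a i j * x j) + q i \<and>
      x i * ((\<Sum>j\<in>S. a i j * x j) + q i) = 0"
    by blast
  show ?case
  proof (cases "m \<in> S")
    \<comment> \<open>The ranking induction does not exclude this case; the set is then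
      unchanged.\<close>
    case True
    then show ?thesis
      using x0 x by (intro exI[of _ x]) (auto simp: insert_absorb)
  next
    case m: False
    define b where "b = (\<Sum>j\<in>S. a m j * x j) + q m"
    \<comment> \<open>This solves the scalar LCP with slope \<open>a m m > 0\<close> and constant
      \<open>b\<close>: zero if \<open>b\<close> is nonnegative, otherwise the value making the row
      vanish.\<close>
    define y where "y = x(m := max 0 (- b / a m m))"
    have am: "0 < a m m"
      using insert.prems by blast
    have sum_y: "(\<Sum>j\<in>S. a i j * y j) = (\<Sum>j\<in>S. a i j * x j)" for i
      using m by (intro sum.cong) (auto simp: y_def)
    have row: "(\<Sum>j\<in>insert m S. a i j * y j) + q i = (\<Sum>j\<in>S. a i j * x j) + q i" if "i \<in> S" for i
    proof -
      have "a i m = 0"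
        using insert.prems(1)[of i m] insert.hyps that m by auto
      then show ?thesis
        using m \<open>finite S\<close> sum_y by simp
    qed
    have row_m: "(\<Sum>j\<in>insert m S. a m j * y j) + q m = a m m * y m + b"
      using m \<open>finite S\<close> sum_y by (simp add: b_def)
    have "0 \<le> y m \<and> 0 \<le> a m m * y m + b \<and> y m * (a m m * y m + b) = 0"
      using am by (auto simp: y_def max_def field_simps)
    then have at_m: "0 \<le> y m \<and> 0 \<le> (\<Sum>j\<in>insert m S. a m j * y j) + q m \<and>
        y m * ((\<Sum>j\<in>insert m S. a m j * y j) + q m) = 0"
      unfolding row_m .
    have on_S: "0 \<le> y i \<and> 0 \<le> (\<Sum>j\<in>insert m S. a i j * y j) + q i \<and>
        y i * ((\<Sum>j\<in>insert m S. a i j * y j) + q i) = 0" if "i \<in> S" for i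
    proof -
      have "y i = x i"
        using that m by (auto simp: y_def)
      then show ?thesis
        unfolding row[OF that] using x[OF that] by (simp only:)
    qed
    have "y i = 0" if "i \<notin> insert m S" for i
      using that x0 by (auto simp: y_def)
    then show ?thesis
      using at_m on_S by blast
  qed
qed

section \<open>Diagonal signs and the classes Q, E and R_0 for ranked matrices\<close>

locale ranked_matrix =
  fixes A :: "real mat" and n :: nat and f :: "nat \<Rightarrow> nat"
  assumes carrier: "A \<in> carrier_mat n n"
    and ranked: "\<And>i j. i < n \<Longrightarrow> j < n \<Longrightarrow> i \<noteq> j \<Longrightarrow> f i \<le> f j \<Longrightarrow> A $$ (i, j) = 0"
begin

text \<open>Off the diagonal, columns of rank at least \<open>f k\<close> have zero entries, and
  those of smaller rank meet zero components of \<open>x\<close>.\<close>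

lemma row_sum:
  assumes k: "k < n" and x: "\<And>j. j < n \<Longrightarrow> f j < f k \<Longrightarrow> x $ j = 0"
  shows "(\<Sum>j<n. A $$ (k, j) * x $ j) = A $$ (k, k) * x $ k"
proof -
  have "(\<Sum>j<n. A $$ (k, j) * x $ j) = (\<Sum>j\<in>{k}. A $$ (k, j) * x $ j)"
  proof (rule sum.mono_neutral_right)
    show "\<forall>j\<in>{..<n} - {k}. A $$ (k, j) * x $ j = 0"
      using ranked[OF k] x by (metis DiffE insertCI lessThan_iff mult_eq_0_iff not_le)
  qed (use k in auto)
  then show ?thesis by simp
qed

text \<open>Once the components of smaller rank vanish, a positive \<open>x $ i\<close> would make
  the complementarity product of row \<open>i\<close> positive. The cutoff \<open>c\<close> allows
  use when the diagonal is known to be positive only below some rank.\<close>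

lemma LCP_component_zero:
  assumes q: "q \<in> carrier_vec n" and x: "x \<in> LCP A q"
    and D: "\<And>j. j < n \<Longrightarrow> f j < c \<Longrightarrow> 0 < A $$ (j, j) \<and> 0 \<le> q $ j"
  shows "i < n \<Longrightarrow> f i < c \<Longrightarrow> x $ i = 0"
proof (induction "f i" arbitrary: i rule: less_induct)
  case less
  have "(\<Sum>j<n. A $$ (i, j) * x $ j) = A $$ (i, i) * x $ i"
    using less by (intro row_sum) auto
  then have "0 \<le> x $ i" and "x $ i * (A $$ (i, i) * x $ i + q $ i) = 0"
    using x less.prems by (auto simp: mem_LCP_iff[OF carrier q])
  then show ?case
    using D[OF less.prems] by (smt (verit) mult_pos_pos no_zero_divisors)
qed

lemma positive_diag_imp_Q:
  assumes "\<forall>i<n. A $$ (i, i) > 0"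
  shows "A \<in> Q_matrices n"
  unfolding Q_matrices_def
proof (intro CollectI conjI carrier ballI)
  fix q :: "real vec" assume q: "q \<in> carrier_vec n"
  obtain x where "\<forall>i\<in>{..<n}. 0 \<le> x i \<and> 0 \<le> (\<Sum>j<n. A $$ (i, j) * x j) + q $ i \<and>
      x i * ((\<Sum>j<n. A $$ (i, j) * x j) + q $ i) = 0"
    using ranked_complementarity_solvable[of "{..<n}" f "\<lambda>i j. A $$ (i, j)" "\<lambda>i. q $ i"] ranked assms
    by auto
  then have "vec n x \<in> LCP A q"
    by (simp add: mem_LCP_iff[OF carrier q])
  then show "LCP A q \<noteq> {}" by blast
qed

lemma Q_imp_positive_diag:
  assumes Q: "A \<in> Q_matrices n"
  shows "\<forall>i<n. A $$ (i, i) > 0"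
proof (rule ccontr)
  assume "\<not> ?thesis"
  then obtain k where k: "k < n" "A $$ (k, k) \<le> 0"
    and min: "\<And>j. j < n \<Longrightarrow> f j < f k \<Longrightarrow> 0 < A $$ (j, j)"
    using ex_has_least_nat[of "\<lambda>i. i < n \<and> A $$ (i, i) \<le> 0" _ f] by (metis not_le)
  \<comment> \<open>The entries 1 force the components of rank below \<open>f k\<close> to vanish;
    the entry -1 then makes row \<open>k\<close> negative, since its diagonal entry is
    nonpositive.\<close>
  define q where "q = vec n (\<lambda>i. if i = k then - 1 else 1 :: real)"
  have q: "q \<in> carrier_vec n"
    by (simp add: q_def)
  obtain x where x: "x \<in> LCP A q"
    using Q q by (auto simp: Q_matrices_def)
  have "x $ j = 0" if "j < n" "f j < f k" for j
    using that min by (intro LCP_component_zero[OF q x, of "f k"]) (auto simp: q_def)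
  then have "(\<Sum>j<n. A $$ (k, j) * x $ j) = A $$ (k, k) * x $ k"
    using k by (intro row_sum) auto
  then have "0 \<le> x $ k" and "0 \<le> A $$ (k, k) * x $ k - 1"
    using x k unfolding mem_LCP_iff[OF carrier q] by (auto simp: q_def)
  with k show False
    by (smt (verit) mult_nonpos_nonneg)
qed

lemma positive_diag_imp_E:
  assumes "\<forall>i<n. A $$ (i, i) > 0"
  shows "A \<in> E_matrices n"
  unfolding E_matrices_def
proof (intro CollectI conjI carrier ballI impI)
  fix d :: "real vec" assume d: "d \<in> carrier_vec n" and "0\<^sub>v n \<le> d"
  then have d0: "0 \<le> d $ i" if "i < n" for i
    using that by (auto simp: less_eq_vec_def)
  have "x = 0\<^sub>v n" if x: "x \<in> LCP A d" for x
  proof (rule eq_vecI)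
    show "dim_vec x = dim_vec (0\<^sub>v n)"
      using x d by (auto simp: LCP_def)
    show "x $ i = 0\<^sub>v n $ i" if "i < dim_vec (0\<^sub>v n)" for i
      \<comment> \<open>The cutoff \<open>Suc (f i)\<close> just includes \<open>i\<close>
        itself.\<close>
      using that assms d0 LCP_component_zero[OF d x, of "Suc (f i)" i] by auto
  qed
  then show "LCP A d = {0\<^sub>v n}"
    using zero_mem_LCP[OF carrier d d0] by blast
qed

lemma R0_nonneg_diag_imp_positive:
  assumes nonneg: "\<forall>i<n. A $$ (i, i) \<ge> 0" and R0: "A \<in> R0_matrices n"
  shows "\<forall>i<n. A $$ (i, i) > 0"
proof (rule ccontr)
  assume neg: "\<not> ?thesis"
  let ?Z = "{i. i < n \<and> A $$ (i, i) = 0}"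
  have "finite ?Z" and "?Z \<noteq> {}"
    using nonneg neg by (simp, force simp: less_le)
  then obtain k where "k \<in> ?Z" and "\<forall>j\<in>?Z. f j \<le> f k"
    using Max_in[of "f ` ?Z"] Max_ge[of "f ` ?Z"]
    by (smt (verit) finite_imageI image_iff image_is_empty)
  then have k: "k < n" "A $$ (k, k) = 0"
    and max: "\<And>j. j < n \<Longrightarrow> f k < f j \<Longrightarrow> 0 < A $$ (j, j)"
    using nonneg by (auto simp: less_le)
  define I where "I = {i. i < n \<and> f k < f i}"
  have "finite I"
    by (simp add: I_def)
  \<comment> \<open>Fixing the component at \<open>k\<close> to 1 turns column \<open>k\<close> into
    the constant term of an LCP on \<open>I\<close>, where the diagonal is positive by maximality of
    \<open>f k\<close>.\<close>
  then obtain y where y0: "\<And>i. i \<notin> I \<Longrightarrow> y i = 0"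
    and y: "\<And>i. i \<in> I \<Longrightarrow> 0 \<le> y i \<and> 0 \<le> (\<Sum>j\<in>I. A $$ (i, j) * y j) + A $$ (i, k) \<and>
      y i * ((\<Sum>j\<in>I. A $$ (i, j) * y j) + A $$ (i, k)) = 0"
    using ranked_complementarity_solvable[of I f "\<lambda>i j. A $$ (i, j)" "\<lambda>i. A $$ (i, k)"] ranked max
    by (auto simp: I_def)
  define x where "x = vec n (\<lambda>i. if i = k then 1 else y i)"
  have "k \<notin> I" and "I \<subseteq> {..<n}"
    by (auto simp: I_def)
  have sum_x: "(\<Sum>j<n. A $$ (i, j) * x $ j) = (\<Sum>j\<in>I. A $$ (i, j) * y j) + A $$ (i, k)" for i
  proof -
    have "(\<Sum>j<n. A $$ (i, j) * x $ j) = (\<Sum>j\<in>insert k I. A $$ (i, j) * x $ j)"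
      using k \<open>I \<subseteq> {..<n}\<close> y0 by (intro sum.mono_neutral_right) (auto simp: x_def)
    also have "\<dots> = A $$ (i, k) + (\<Sum>j\<in>I. A $$ (i, j) * x $ j)"
      using k \<open>finite I\<close> \<open>k \<notin> I\<close> by (simp add: x_def)
    also have "(\<Sum>j\<in>I. A $$ (i, j) * x $ j) = (\<Sum>j\<in>I. A $$ (i, j) * y j)"
      by (intro sum.cong) (auto simp: x_def I_def)
    finally show ?thesis by simp
  qed
  \<comment> \<open>Rows outside \<open>I\<close> have rank at most \<open>f k\<close>, so they
    vanish on \<open>I\<close> and in column \<open>k\<close>; for row \<open>k\<close> the latter
    is the zero diagonal entry. Hence the component 1 at \<open>k\<close> is complementary.\<close>
  have outside: "(\<Sum>j\<in>I. A $$ (i, j) * y j) + A $$ (i, k) = 0" if "i < n" "i \<notin> I" for i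
  proof -
    have "f i \<le> f k"
      using that by (auto simp: I_def)
    have "A $$ (i, k) = 0"
      using \<open>f i \<le> f k\<close> that k ranked[of i k] by (cases "i = k") auto
    moreover have "A $$ (i, j) = 0" if "j \<in> I" for j
      using \<open>f i \<le> f k\<close> \<open>i < n\<close> that by (intro ranked) (auto simp: I_def)
    ultimately show ?thesis by simp
  qed
  have "x \<in> LCP A (0\<^sub>v n)"
    unfolding mem_LCP_iff[OF carrier zero_carrier_vec]
  proof (intro conjI allI impI)
    show "x \<in> carrier_vec n"
      by (simp add: x_def)
    fix i assume i: "i < n"
    show "0 \<le> x $ i"
      using i y[of i] y0[of i] by (cases "i \<in> I") (auto simp: x_def)
    show "0 \<le> (\<Sum>j<n. A $$ (i, j) * x $ j) + 0\<^sub>v n $ i"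
      using i y[of i] outside[of i] by (cases "i \<in> I") (auto simp: sum_x)
    show "x $ i * ((\<Sum>j<n. A $$ (i, j) * x $ j) + 0\<^sub>v n $ i) = 0"
      unfolding sum_x using i y[of i] outside[of i] \<open>k \<notin> I\<close>
      by (cases "i \<in> I") (auto simp: x_def)
  qed
  then have "x = 0\<^sub>v n"
    using R0 by (auto simp: R0_matrices_def)
  then have "x $ k = 0"
    using k by simp
  then show False
    using k by (simp add: x_def)
qed

end

section \<open>Implications from E and E_0 for arbitrary square matrices\<close>

lemma E_subset_Rstar: "E_matrices n \<subseteq> Rstar_matrices n"
  \<comment> \<open>The choice \<open>d = 0\<close> gives R_0, and positive \<open>d\<close> gives
    E_0.\<close>
  unfolding E_matrices_def Rstar_matrices_def R0_matrices_def E0_matrices_def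
  by (auto simp: less_eq_vec_def less_imp_le)

lemma E0_imp_nonneg_diag:
  assumes E0: "A \<in> E0_matrices n" and k: "k < n"
  shows "A $$ (k, k) \<ge> 0"
proof (rule ccontr)
  assume neg: "\<not> ?thesis"
  have A: "A \<in> carrier_mat n n"
    using E0 by (simp add: E0_matrices_def)
  \<comment> \<open>Chosen so that the unit vector at \<open>k\<close> is a solution: row
    \<open>k\<close> cancels exactly, the other rows stay positive, and \<open>d\<close> is positive
    if the diagonal entry at \<open>k\<close> is negative.\<close>
  define d where "d = vec n (\<lambda>i. if i = k then - A $$ (k, k) else 1 + \<bar>A $$ (i, k)\<bar>)"
  have d: "d \<in> carrier_vec n"
    by (simp add: d_def)
  have "(\<Sum>j<n. A $$ (i, j) * unit_vec n k $ j) = A $$ (i, k)" for i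
  proof -
    have "(\<Sum>j<n. A $$ (i, j) * unit_vec n k $ j) = (\<Sum>j<n. if j = k then A $$ (i, j) else 0)"
      using k by (intro sum.cong) auto
    then show ?thesis
      using k by simp
  qed
  then have "unit_vec n k \<in> LCP A d"
    unfolding mem_LCP_iff[OF A d] using k by (auto simp: d_def simp del: index_unit_vec) (auto simp: d_def)
  moreover have "LCP A d = {0\<^sub>v n}"
  proof -
    have "\<forall>i<n. 0 < d $ i"
      using neg by (auto simp: d_def)
    then show ?thesis
      using E0 d by (simp add: E0_matrices_def)
  qed
  ultimately have "(unit_vec n k :: real vec) $ k = 0\<^sub>v n $ k"
    by simp
  then show False
    using k by simp
qed

section \<open>Triangular matrices as ranked matrices\<close>

lemma triangular_imp_ranked:
  assumes A: "A \<in> carrier_mat n n" and "triangular A"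
  shows "\<exists>f. ranked_matrix A n f"
proof -
  consider "upper_triangular A" | "lower_triangular A"
    using assms by (auto simp: triangular_def)
  then show ?thesis
  proof cases
    case 1
    \<comment> \<open>In the upper case a row involves columns of larger index, so the rank must
      decrease; truncated subtraction is harmless for \<open>i < n\<close>.\<close>
    then have "ranked_matrix A n (\<lambda>i. n - i)"
      using A by unfold_locales (auto intro!: upper_triangularD)
    then show ?thesis by blast
  next
    case 2
    have "A $$ (i, j) = 0" if "i < j" "j < n" for i j
      using upper_triangularD[of "transpose_mat A" i j] 2 that A by (auto simp: lower_triangular_def)
    then have "ranked_matrix A n (\<lambda>i. i)"
      using A by unfold_locales auto
    then show ?thesis by blast
  qed
qed

section \<open>Principal minors of triangular matrices\<close>

lemma det_upper_triangular_pos: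
  assumes "upper_triangular B" and "B \<in> carrier_mat m m" and "\<And>i. i < m \<Longrightarrow> 0 < B $$ (i, i)"
  shows "0 < det (B :: real mat)"
proof -
  have "det B = (\<Prod>i<m. B $$ (i, i))"
    using assms by (simp add: det_upper_triangular prod_list_diag_prod lessThan_atLeast0)
  then show ?thesis
    using assms by (auto intro: prod_pos)
qed

text \<open>Minors of order one are the diagonal entries. Conversely, a principal submatrix is again
  triangular, so its determinant is the product of the selected diagonal entries.\<close>

lemma triangular_P_iff:
  assumes A: "A \<in> carrier_mat n n" and tri: "triangular A"
  shows "A \<in> P_matrices n \<longleftrightarrow> (\<forall>i<n. A $$ (i, i) > 0)"
proof
  assume P: "A \<in> P_matrices n"
  show "\<forall>i<n. A $$ (i, i) > 0"
  proof (intro allI impI)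
    fix k assume k: "k < n"
    have "{i. i < n \<and> i \<in> {k}} = {k}"
      using k by auto
    then have card: "card {i. i < n \<and> i \<in> {k}} = 1"
      by simp
    have pick: "pick {k} 0 = k"
      by (simp add: Least_equality)
    have "submatrix A {k} {k} \<in> carrier_mat 1 1"
      using A card by (intro carrier_matI) (auto simp: dim_submatrix)
    then have "det (submatrix A {k} {k}) = submatrix A {k} {k} $$ (0, 0)"
      by (rule det_single)
    also have "\<dots> = A $$ (k, k)"
      using A card pick submatrix_index[of 0 A "{k}" 0 "{k}"] by simp
    finally show "A $$ (k, k) > 0"
      using P k by (auto simp: P_matrices_def)
  qed
next
  assume pos: "\<forall>i<n. A $$ (i, i) > 0"
  have "0 < det (submatrix A I I)" if I: "I \<noteq> {}" "I \<subseteq> {..<n}" for I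
  proof -
    define m where "m = card I"
    define B where "B = submatrix A I I"
    have I_eq: "{i. i < n \<and> i \<in> I} = I"
      using I by auto
    have B: "B \<in> carrier_mat m m"
      using A by (intro carrier_matI) (auto simp: B_def m_def dim_submatrix I_eq)
    have B_index: "B $$ (i, j) = A $$ (pick I i, pick I j)" if "i < m" "j < m" for i j
      using that A unfolding B_def m_def by (intro submatrix_index) (auto simp: I_eq)
    have pick_less: "pick I i < n" if "i < m" for i
      using that I pick_in_set_le[of i I] by (auto simp: m_def)
    \<comment> \<open>Increasing selection keeps entries on their side of the diagonal, so
      triangularity is inherited.\<close>
    have pick_mono: "pick I i < pick I j" if "i < j" "j < m" for i j
      using that pick_mono_le[of j I i] by (auto simp: m_def)
    have diag: "0 < B $$ (i, i)" if "i < m" for i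
      using that pos pick_less B_index by simp
    consider "upper_triangular A" | "lower_triangular A"
      using tri by (auto simp: triangular_def)
    then have "0 < det B"
    proof cases
      case 1
      have "A $$ (i, j) = 0" if "j < i" "i < n" for i j
        using upper_triangularD[of A j i] 1 that A by auto
      then have "upper_triangular B"
        using B by (auto simp: B_index pick_less pick_mono)
      then show ?thesis
        using B diag by (rule det_upper_triangular_pos)
    next
      case 2
      have "A $$ (i, j) = 0" if "i < j" "j < n" for i j
        using upper_triangularD[of "transpose_mat A" i j] 2 that A by (auto simp: lower_triangular_def)
      then have "upper_triangular (transpose_mat B)"
        using B by (auto simp: B_index pick_less pick_mono)
      then have "0 < det (transpose_mat B)"
        using B diag by (intro det_upper_triangular_pos) auto
      then show ?thesis
        using B by (simp add: det_transpose)
    qed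
    then show ?thesis
      by (simp add: B_def)
  qed
  then show "A \<in> P_matrices n"
    using A by (simp add: P_matrices_def)
qed

theorem theorem3p1:
  fixes A :: "real mat" and n :: nat
  assumes "A \<in> carrier_mat n n"
    and "triangular A"
  shows "(A \<in> Q_matrices n \<longleftrightarrow> (\<forall>i<n. A $$ (i, i) > 0))
    \<and> (A \<in> Q_matrices n \<longleftrightarrow> A \<in> P_matrices n)
    \<and> (A \<in> Q_matrices n \<longleftrightarrow> A \<in> E_matrices n)
    \<and> (A \<in> Q_matrices n \<longleftrightarrow> (\<forall>i<n. A $$ (i, i) \<ge> 0) \<and> A \<in> R0_matrices n)
    \<and> (A \<in> Q_matrices n \<longleftrightarrow> A \<in> Rstar_matrices n)"
proof -
  obtain f where "ranked_matrix A n f"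
    using triangular_imp_ranked[OF assms] by blast
  then interpret ranked_matrix A n f .
  let ?pos = "\<forall>i<n. A $$ (i, i) > 0"
  have Q: "A \<in> Q_matrices n \<longleftrightarrow> ?pos"
    using positive_diag_imp_Q Q_imp_positive_diag by blast
  have P: "A \<in> P_matrices n \<longleftrightarrow> ?pos"
    using triangular_P_iff[OF assms] .
  \<comment> \<open>The remaining conditions form a cycle: positive diagonal, E, R*, nonnegative
    diagonal with R_0, positive diagonal.\<close>
  have pos_E: "?pos \<Longrightarrow> A \<in> E_matrices n"
    by (rule positive_diag_imp_E)
  have E_Rstar: "A \<in> E_matrices n \<Longrightarrow> A \<in> Rstar_matrices n"
    using E_subset_Rstar by blast
  have Rstar_R0: "A \<in> Rstar_matrices n \<Longrightarrow> (\<forall>i<n. A $$ (i, i) \<ge> 0) \<and> A \<in> R0_matrices n"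
    using E0_imp_nonneg_diag by (auto simp: Rstar_matrices_def)
  have R0_pos: "(\<forall>i<n. A $$ (i, i) \<ge> 0) \<and> A \<in> R0_matrices n \<Longrightarrow> ?pos"
    using R0_nonneg_diag_imp_positive by blast
  show ?thesis
    using Q P pos_E E_Rstar Rstar_R0 R0_pos by argo
qed

end
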